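(* Let $\lambda$ be a regular cardinal and let $\mathbb P=\langle P,\leq\rangle$ be a rooted, well founded, $<\!\lambda$-directed poset such that $|P|=|L_1|=\kappa\geq\lambda=\mathrm{ht}(\mathbb P)\geq\omega$ and $|(\cdot,p]|<\lambda$ for all $p\in P$. Then $\mathbb P$ is not reversible.
   Context: A poset $\mathbb P=\langle P,\leq\rangle$ is reversible iff each bijection $f:P\to P$ with $x\leq y\Rightarrow f(x)\leq f(y)$ for all $x,y$ is an automorphism. $\mathbb P$ is well founded iff each non-empty subset of $P$ has a minimal element. For a well founded poset the levels are defined by $L_0=\mathrm{Min}(P)$ (the set of minimal elements) and $L_\alpha=\mathrm{Min}(P\setminus\bigcup_{\beta<\alpha}L_\beta)$, and the height $\mathrm{ht}(\mathbb P)$ is the (least) ordinal $\xi$ with $P=\bigcup_{\alpha<\xi}L_\alpha$. The poset is rooted iff it has a least element (its root). It is $<\!\lambda$-directed iff each set $S\subset P$ of size $<\lambda$ has an upper bound in $P$. For $p\in P$, $(\cdot,p]=\{q\in P:q\leq p\}$. *)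

theory Defs
  imports Main
begin

unbundle cardinal_syntax

text \<open>
  A poset is a carrier \<open>P\<close> together with a relation \<open>le\<close> such that
  \<open>partial_order_on P le\<close>; \<open>(x, y) \<in> le\<close> stands for \<open>x \<le> y\<close>.
  Since HOL has no type of all ordinals, an ordinal is represented by a well-order \<open>r\<close>
  (up to isomorphism), the ordinals below it by the elements of \<open>Field r\<close>, and the order of
  ordinals by \<open><o\<close>, \<open>\<le>o\<close>; cardinals are the well-orders satisfying \<open>Card_order\<close>.
\<close>

definition poset_automorphism :: "'a set \<Rightarrow> 'a rel \<Rightarrow> ('a \<Rightarrow> 'a) \<Rightarrow> bool" where
  "poset_automorphism P le f \<longleftrightarrow>
     bij_betw f P P \<and> (\<forall>x\<in>P. \<forall>y\<in>P. (x, y) \<in> le \<longleftrightarrow> (f x, f y) \<in> le)"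

definition reversible :: "'a set \<Rightarrow> 'a rel \<Rightarrow> bool" where
  "reversible P le \<longleftrightarrow>
     (\<forall>f. bij_betw f P P \<and> (\<forall>x\<in>P. \<forall>y\<in>P. (x, y) \<in> le \<longrightarrow> (f x, f y) \<in> le)
        \<longrightarrow> poset_automorphism P le f)"

definition min_elements :: "'a rel \<Rightarrow> 'a set \<Rightarrow> 'a set" where
  "min_elements le A = {x \<in> A. \<forall>y\<in>A. (y, x) \<in> le \<longrightarrow> y = x}"

definition well_founded_poset :: "'a set \<Rightarrow> 'a rel \<Rightarrow> bool" where
  "well_founded_poset P le \<longleftrightarrow> (\<forall>A\<subseteq>P. A \<noteq> {} \<longrightarrow> min_elements le A \<noteq> {})"

definition rooted :: "'a set \<Rightarrow> 'a rel \<Rightarrow> bool" where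
  "rooted P le \<longleftrightarrow> (\<exists>z\<in>P. \<forall>p\<in>P. (z, p) \<in> le)"

definition directed_below :: "'a set \<Rightarrow> 'a rel \<Rightarrow> 'b rel \<Rightarrow> bool" where
  "directed_below P le lam \<longleftrightarrow>
     (\<forall>S\<subseteq>P. |S| <o lam \<longrightarrow> (\<exists>u\<in>P. \<forall>s\<in>S. (s, u) \<in> le))"

definition down_set :: "'a set \<Rightarrow> 'a rel \<Rightarrow> 'a \<Rightarrow> 'a set" where
  "down_set P le p = {q \<in> P. (q, p) \<in> le}"

text \<open>
  \<open>level P le r a\<close> is the level of \<open>P\<close> indexed by the ordinal that \<open>a\<close> represents in
  the well-order \<open>r\<close>, i.e. the order type of \<open>underS r a\<close>. The recursion is the lemma
  \<open>level_unfold\<close>; by \<open>level_embed\<close> the value depends only on that ordinal and not on \<open>r\<close>.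
\<close>

definition level :: "'a set \<Rightarrow> 'a rel \<Rightarrow> 'b rel \<Rightarrow> 'b \<Rightarrow> 'a set" where
  "level P le r = wfrec (r - Id) (\<lambda>L a. min_elements le (P - (\<Union>b\<in>underS r a. L b)))"

lemma level_unfold:
  assumes "Well_order r"
  shows "level P le r a = min_elements le (P - (\<Union>b\<in>underS r a. level P le r b))"
proof -
  have wf: "wf (r - Id)"
    using assms by (simp add: well_order_on_def)
  have "(\<Union>b\<in>underS r a. cut (level P le r) (r - Id) a b) = (\<Union>b\<in>underS r a. level P le r b)"
    by (auto simp: cut_def underS_def)
  then show ?thesis
    using wfrec[OF wf, of "\<lambda>L a. min_elements le (P - (\<Union>b\<in>underS r a. L b))" a]
    by (simp add: level_def)
qed

lemma level_embed:
  assumes "Well_order r" and "Well_order r'" and "embed r r' f" and "a \<in> Field r"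
  shows "level P le r' (f a) = level P le r a"
proof -
  have wf: "wf (r - Id)"
    using assms(1) by (simp add: well_order_on_def)
  show ?thesis
    using wf assms(4)
  proof (induction a rule: wf_induct_rule)
    case (less a)
    have im: "underS r' (f a) = f ` underS r a"
      using embed_underS[OF assms(1,3) less.prems] by (simp add: bij_betw_def)
    have "level P le r' (f b) = level P le r b" if "b \<in> underS r a" for b
      using less.IH[of b] that by (auto simp: underS_def intro: FieldI1)
    then show ?case
      by (simp add: level_unfold[OF assms(1), of P le a] level_unfold[OF assms(2), of P le "f a"] im)
  qed
qed

text \<open>\<open>natLeq\<close> is the ordinal \<open>\<omega>\<close>, so finite levels can be written with natural numbers.\<close>

abbreviation fin_level :: "'a set \<Rightarrow> 'a rel \<Rightarrow> nat \<Rightarrow> 'a set" where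
  "fin_level P le n \<equiv> level P le natLeq n"

lemma fin_level_0: "fin_level P le 0 = min_elements le P"
  by (subst level_unfold[OF natLeq_Well_order]) (simp add: natLeq_underS_less)

lemma fin_level_1: "fin_level P le 1 = min_elements le (P - fin_level P le 0)"
proof -
  have "{x. x < (1::nat)} = {0}" by auto
  then show ?thesis
    by (subst level_unfold[OF natLeq_Well_order]) (simp add: natLeq_underS_less)
qed

text \<open>
  \<open>is_height P le r\<close>: the ordinal \<open>r\<close> is the least one whose levels cover \<open>P\<close>.
  It is enough to let \<open>s\<close> range over well-orders on the type of \<open>r\<close>, since every
  ordinal below \<open>r\<close> is represented by an initial segment of \<open>r\<close>.
\<close>

definition is_height :: "'a set \<Rightarrow> 'a rel \<Rightarrow> 'b rel \<Rightarrow> bool" where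
  "is_height P le r \<longleftrightarrow>
     Well_order r \<and> P = (\<Union>a\<in>Field r. level P le r a) \<and>
     (\<forall>s :: 'b rel. s <o r \<longrightarrow> P \<noteq> (\<Union>a\<in>Field s. level P le s a))"

end

theory Submission
  imports Defs
begin

text \<open>
  Call the elements of level 1 atoms. Since \<open>P\<close> is covered by the principal ideals of the upper
  bounds of any small set, every set of fewer than \<open>\<lambda>\<close> elements has \<open>\<kappa>\<close> upper bounds. Choose a
  well-order of \<open>P\<close> that extends the order and whose proper initial segments have fewer than
  \<open>\<kappa>\<close> elements, and define \<open>f\<close> by recursion along it: the root is fixed, an atom is sent to the
  first value not yet used, and any other element to an unused upper bound of the images of the
  elements below it. Such an \<open>f\<close> is injective and monotone. It is surjective because a value
  that is never used would confine the images of the \<open>\<kappa>\<close> atoms to an initial segment. If the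
  atoms give priority to some value \<open>y\<^sub>0\<close> which is not an atom, then the first atom is
  sent to \<open>y\<^sub>0\<close>, so \<open>f\<close> is not an automorphism.
\<close>

section \<open>Cardinal bounds for unions and for sets of upper bounds\<close>

lemma finite_card_of_ordLess:
  assumes "finite A" and "natLeq \<le>o r"
  shows "|A| <o r"
  using assms finite_iff_ordLess_natLeq ordLess_ordLeq_trans by blast

text \<open>If the index set is smaller than \<open>lam\<close>, regularity keeps the union below
  \<open>lam\<close>. Otherwise every piece has at most \<open>|I|\<close> elements, and so does the
  union. Hence \<open>|B|\<close> itself may be singular.\<close>

lemma card_of_UNION_ordLess_regular:
  assumes "Card_order lam" and "natLeq \<le>o lam" and "regularCard lam"
    and "lam \<le>o |B|" and "|I| <o |B|" and "\<And>i. i \<in> I \<Longrightarrow> |A i| <o lam"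
  shows "|\<Union>i\<in>I. A i| <o |B|"
proof -
  have cinf: "Cinfinite lam"
    using assms(1,2) natLeq_cinfinite cinfinite_mono by blast
  show ?thesis
  proof (cases "|I| <o lam")
    case True
    then have "|\<Union>i\<in>I. A i| <o lam"
      using card_of_UNION_ordLess_infinite_Field_regularCard[OF assms(3) cinf] assms(6) by blast
    then show ?thesis
      using assms(4) ordLess_ordLeq_trans by blast
  next
    case False
    then have le: "lam \<le>o |I|"
      using assms(1) card_of_Well_order card_order_on_well_order_on not_ordLess_iff_ordLeq by blast
    then have "infinite I"
      using assms(2) infinite_iff_natLeq_ordLeq ordLeq_transitive by blast
    moreover have "\<forall>i\<in>I. |A i| \<le>o |I|"
      using assms(6) le ordLess_imp_ordLeq ordLeq_transitive by blast
    ultimately have "|\<Union>i\<in>I. A i| \<le>o |I|"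
      using card_of_UNION_ordLeq_infinite card_of_refl ordIso_iff_ordLeq by blast
    then show ?thesis
      using assms(5) ordLeq_ordLess_trans by blast
  qed
qed

text \<open>Directedness applied to \<open>S\<close> together with one more point \<open>p\<close>
  puts \<open>p\<close> below an upper bound of \<open>S\<close>. The ideals of these bounds thus
  cover \<open>P\<close>, which fewer than \<open>|P|\<close> small ideals cannot do.\<close>

lemma card_of_upper_bounds:
  assumes lam: "Card_order lam" "natLeq \<le>o lam" "regularCard lam" "lam \<le>o |P|"
    and dir: "directed_below P le lam"
    and down: "\<forall>p\<in>P. |down_set P le p| <o lam"
    and S: "S \<subseteq> P" "|S| <o lam"
  shows "\<not> |{u \<in> P. \<forall>s\<in>S. (s, u) \<in> le}| <o |P|"
proof
  let ?U = "{u \<in> P. \<forall>s\<in>S. (s, u) \<in> le}"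
  assume "|?U| <o |P|"
  then have small: "|\<Union>u\<in>?U. down_set P le u| <o |P|"
    by (rule card_of_UNION_ordLess_regular[OF lam]) (use down in blast)
  have inf: "infinite (Field lam)"
    using lam(1,2) natLeq_cinfinite cinfinite_mono cinfinite_def by blast
  have "P \<subseteq> (\<Union>u\<in>?U. down_set P le u)"
  proof
    fix p assume p: "p \<in> P"
    have "|{p}| <o lam"
      using lam(2) by (simp add: finite_card_of_ordLess)
    then have "|{p} \<union> S| <o lam"
      using card_of_Un_ordLess_infinite_Field[OF inf lam(1)] S(2) by blast
    moreover have "{p} \<union> S \<subseteq> P"
      using p S(1) by blast
    ultimately obtain u where "u \<in> P" "\<forall>s\<in>{p} \<union> S. (s, u) \<in> le"
      using dir unfolding directed_below_def by blast
    then show "p \<in> (\<Union>u\<in>?U. down_set P le u)"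
      using p by (auto simp: down_set_def)
  qed
  then have "|P| \<le>o |\<Union>u\<in>?U. down_set P le u|"
    by (rule card_of_mono1)
  with small show False
    using not_ordLess_ordLeq by blast
qed

section \<open>A linear extension with small initial segments\<close>

lemma well_order_least:
  assumes "Well_order r" and "A \<subseteq> Field r" and "A \<noteq> {}"
  obtains a where "a \<in> A" and "\<And>b. b \<in> A \<Longrightarrow> (a, b) \<in> r"
proof -
  have wo: "wo_rel r"
    using assms(1) by (simp add: wo_rel_def)
  show thesis
    using that wo_rel.minim_in[OF wo assms(2,3)] wo_rel.minim_least[OF wo assms(2)] by blast
qed

text \<open>The rank \<open>h p\<close> is the least index of a level containing \<open>p\<close>.
  Since \<open>q\<close> is minimal among the points outside the levels before \<open>h q\<close>,
  any point strictly below \<open>q\<close> already lies in one of those levels.\<close>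

lemma is_height_rank:
  assumes "is_height P le r"
  obtains h where "\<And>p. p \<in> P \<Longrightarrow> h p \<in> Field r"
    and "\<And>p q. \<lbrakk>p \<in> P; q \<in> P; (p, q) \<in> le; p \<noteq> q\<rbrakk> \<Longrightarrow> (h p, h q) \<in> r - Id"
proof -
  have wo: "Well_order r" and P: "P = (\<Union>a\<in>Field r. level P le r a)"
    using assms by (auto simp: is_height_def)
  have antisym: "antisym r" and trans: "trans r"
    using wo by (auto simp: order_on_defs)
  have "\<exists>a. a \<in> Field r \<and> p \<in> level P le r a \<and> (\<forall>b\<in>Field r. p \<in> level P le r b \<longrightarrow> (a, b) \<in> r)"
    if "p \<in> P" for p
  proof -
    have "{a \<in> Field r. p \<in> level P le r a} \<noteq> {}"
      using that P by blast
    then obtain a where "a \<in> {a \<in> Field r. p \<in> level P le r a}"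
      "\<And>b. b \<in> {a \<in> Field r. p \<in> level P le r a} \<Longrightarrow> (a, b) \<in> r"
      using well_order_least[OF wo, of "{a \<in> Field r. p \<in> level P le r a}"] by blast
    then show ?thesis
      by blast
  qed
  then obtain h where h: "\<And>p. p \<in> P \<Longrightarrow> h p \<in> Field r" "\<And>p. p \<in> P \<Longrightarrow> p \<in> level P le r (h p)"
    "\<And>p b. \<lbrakk>p \<in> P; b \<in> Field r; p \<in> level P le r b\<rbrakk> \<Longrightarrow> (h p, b) \<in> r"
    by metis
  show thesis
  proof (rule that[of h])
    fix p q assume pq: "p \<in> P" "q \<in> P" "(p, q) \<in> le" "p \<noteq> q"
    have "q \<in> min_elements le (P - (\<Union>b\<in>underS r (h q). level P le r b))"
      using h(2)[OF pq(2)] level_unfold[OF wo] by metis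
    then obtain b where b: "b \<in> underS r (h q)" "p \<in> level P le r b"
      using pq by (auto simp: min_elements_def)
    then have "(b, h q) \<in> r" "b \<noteq> h q"
      by (auto simp: underS_def)
    moreover from this have "(h p, b) \<in> r"
      using h(3) pq(1) b(2) FieldI1 by metis
    ultimately show "(h p, h q) \<in> r - Id"
      using antisym trans by (auto dest: antisymD transD)
  qed (fact h(1))
qed

text \<open>Ordering by rank alone could put \<open>|P|\<close> elements of one level before a point
  of a higher one. So points are sorted first by the \<open>w\<close>-least element above them; the
  proper segments of \<open>w\<close> are small because \<open>w\<close> is the cardinal order of
  \<open>P\<close>.\<close>

lemma linear_extension_small_segments:
  fixes P :: "'a set" and le :: "'a rel" and lam :: "'b rel"
  assumes lam: "Card_order lam" "natLeq \<le>o lam" "regularCard lam" "lam \<le>o |P|"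
    and po: "partial_order_on P le"
    and height: "is_height P le r"
    and down: "\<forall>p\<in>P. |down_set P le p| <o lam"
  obtains R where "wf R" and "R \<subseteq> P \<times> P" and "total_on P R"
    and "\<And>x y. \<lbrakk>(x, y) \<in> le; x \<noteq> y\<rbrakk> \<Longrightarrow> (x, y) \<in> R"
    and "\<And>x. x \<in> P \<Longrightarrow> |{y. (y, x) \<in> R}| <o |P|"
proof -
  obtain h where h: "\<And>p. p \<in> P \<Longrightarrow> h p \<in> Field r"
    "\<And>p q. \<lbrakk>p \<in> P; q \<in> P; (p, q) \<in> le; p \<noteq> q\<rbrakk> \<Longrightarrow> (h p, h q) \<in> r - Id"
    using is_height_rank[OF height] by blast
  have wor: "Well_order r"
    using height by (simp add: is_height_def)
  define w where "w = |P|"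
  have wow: "Well_order w" and Fw: "Field w = P"
    unfolding w_def by (rule card_of_Well_order, rule Field_card_of)
  have trans_le: "trans le" and le_P: "le \<subseteq> P \<times> P" and refl_le: "\<And>p. p \<in> P \<Longrightarrow> (p, p) \<in> le"
    using po by (auto simp: order_on_defs refl_on_def)
  have natLeqP: "natLeq \<le>o |P|"
    using lam(2,4) by (rule ordLeq_transitive)
  then have infP: "infinite P"
    using infinite_iff_natLeq_ordLeq by blast
  have "\<exists>q. q \<in> P \<and> (p, q) \<in> le \<and> (\<forall>q'\<in>P. (p, q') \<in> le \<longrightarrow> (q, q') \<in> w)" if "p \<in> P" for p
  proof -
    have "p \<in> {q \<in> P. (p, q) \<in> le}"
      using that refl_le by simp
    then obtain q where "q \<in> {q \<in> P. (p, q) \<in> le}" "\<And>q'. q' \<in> {q \<in> P. (p, q) \<in> le} \<Longrightarrow> (q, q') \<in> w"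
      using well_order_least[OF wow, of "{q \<in> P. (p, q) \<in> le}"] Fw by blast
    then show ?thesis
      by blast
  qed
  then obtain g where g: "\<And>p. p \<in> P \<Longrightarrow> g p \<in> P" "\<And>p. p \<in> P \<Longrightarrow> (p, g p) \<in> le"
    "\<And>p q. \<lbrakk>p \<in> P; q \<in> P; (p, q) \<in> le\<rbrakk> \<Longrightarrow> (g p, q) \<in> w"
    by metis
  \<comment> \<open>The fibres of \<open>g\<close> lie in principal ideals, so ordering by \<open>g\<close> first keeps segments small.\<close>
  define R where
    "R = inv_image ((w - Id) <*lex*> (r - Id) <*lex*> (w - Id)) (\<lambda>x. (g x, h x, x)) \<inter> P \<times> P"
  have wfs: "wf (w - Id)" "wf (r - Id)"
    using wow wor by (simp_all add: well_order_on_def)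
  have "total_on P R"
  proof (rule total_onI)
    fix x y assume "x \<in> P" "y \<in> P" "x \<noteq> y"
    moreover have "total_on P w" "total_on (Field r) r"
      using wow wor Fw by (simp_all add: order_on_defs)
    ultimately show "(x, y) \<in> R \<or> (y, x) \<in> R"
      using g(1) h(1) unfolding R_def total_on_def by (simp add: in_lex_prod) metis
  qed
  moreover have "wf R"
    unfolding R_def by (intro wf_Int1 wf_inv_image wf_lex_prod wfs)
  moreover have "(x, y) \<in> R" if "(x, y) \<in> le" "x \<noteq> y" for x y
  proof -
    have P: "x \<in> P" "y \<in> P"
      using that(1) le_P by auto
    \<comment> \<open>Thus \<open>g y\<close> competes in the minimum that defines
      \<open>g x\<close>, which makes \<open>g\<close> monotone from \<open>le\<close> to
      \<open>w\<close>.\<close>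
    moreover have "(x, g y) \<in> le"
      using trans_le that(1) g(2)[OF P(2)] by (blast dest: transD)
    ultimately have "(g x, g y) \<in> w"
      using g by blast
    \<comment> \<open>When \<open>g x = g y\<close>, the strict increase of the rank decides; the
      third component of \<open>R\<close> serves only totality.\<close>
    then show ?thesis
      using P h(2)[OF P that] by (auto simp: R_def)
  qed
  moreover have "|{y. (y, x) \<in> R}| <o |P|" if "x \<in> P" for x
  proof -
    let ?I = "{g x} \<union> underS w (g x)"
    have "|underS w (g x)| <o |P|"
      using card_of_underS[OF card_of_Card_order, of "g x" P] g(1)[OF that] by (simp add: w_def Field_card_of)
    moreover have "|{g x}| <o |P|"
      by (rule finite_card_of_ordLess[OF _ natLeqP]) simp
    ultimately have I: "|?I| <o |P|"
      using card_of_Un_ordLess_infinite[OF infP] by blast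
    have "?I \<subseteq> P"
      using g(1)[OF that] Fw by (auto simp: underS_def dest: FieldI1)
    then have "|\<Union>q\<in>?I. down_set P le q| <o |P|"
      using card_of_UNION_ordLess_regular[OF lam I] down by blast
    moreover have "{y. (y, x) \<in> R} \<subseteq> (\<Union>q\<in>?I. down_set P le q)"
    proof
      fix y assume "y \<in> {y. (y, x) \<in> R}"
      then have "y \<in> P" "g y \<in> ?I"
        by (auto simp: R_def underS_def)
      then show "y \<in> (\<Union>q\<in>?I. down_set P le q)"
        using g(2) unfolding down_set_def by blast
    qed
    ultimately show ?thesis
      using card_of_mono1 ordLeq_ordLess_trans by blast
  qed
  moreover have "R \<subseteq> P \<times> P"
    by (auto simp: R_def)
  ultimately show thesis
    using that by blast
qed

lemma fin_level_1_rooted: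
  assumes "partial_order_on P le" and "z \<in> P" and "\<forall>p\<in>P. (z, p) \<in> le"
  shows "fin_level P le 1 = min_elements le (P - {z})"
proof -
  have "antisym le"
    using assms(1) by (simp add: order_on_defs)
  then have "min_elements le P = {z}"
    using assms(2,3) by (auto simp: min_elements_def dest: antisymD)
  then show ?thesis
    by (simp only: fin_level_1 fin_level_0)
qed

theorem theorem5p3:
  fixes P :: "'a set" and le :: "'a rel" and lam :: "'b rel" and kap :: "'c rel"
  assumes "Card_order lam" and "natLeq \<le>o lam" and "regularCard lam"
    and "Card_order kap" and "lam \<le>o kap"
    and "partial_order_on P le"
    and "rooted P le"
    and "well_founded_poset P le"
    and "directed_below P le lam"
    and "|P| =o kap"
    and "|fin_level P le 1| =o kap"
    and "is_height P le lam"
    and "\<forall>p\<in>P. |down_set P le p| <o lam"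
  shows "\<not> reversible P le"
proof -
  obtain z where z: "z \<in> P" "\<forall>p\<in>P. (z, p) \<in> le"
    using assms(7) by (auto simp: rooted_def)
  define At where "At = min_elements le (P - {z})"
  have antisym: "antisym le" and refl_le: "\<And>p. p \<in> P \<Longrightarrow> (p, p) \<in> le" and le_P: "le \<subseteq> P \<times> P"
    using assms(6) by (auto simp: order_on_defs refl_on_def)
  have lamP: "lam \<le>o |P|"
    using assms(5,10) ordIso_symmetric ordLeq_ordIso_trans by blast
  note lam = assms(1-3) lamP
  have AtP: "At \<subseteq> P" and zAt: "z \<notin> At"
    by (auto simp: At_def min_elements_def)
  have cardAt: "\<not> |At| <o |P|"
    using assms(10,11) fin_level_1_rooted[OF assms(6) z] ordIso_symmetric ordIso_transitive
      not_ordLess_ordIso unfolding At_def by metis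
  have natLeqP: "natLeq \<le>o |P|"
    using lam(2,4) by (rule ordLeq_transitive)
  then have infP: "infinite P"
    using infinite_iff_natLeq_ordLeq by blast
  have below_At: "y = z" if "x \<in> At" "(y, x) \<in> le" "y \<noteq> x" for x y
    using that le_P by (auto simp: At_def min_elements_def)
  note ub = card_of_upper_bounds[OF lam assms(9,13)]
  have sing: "|{p}| <o |P|" "|{p}| <o lam" for p :: 'a
    by (rule finite_card_of_ordLess[OF _ natLeqP], simp)
      (rule finite_card_of_ordLess[OF _ assms(2)], simp)

  have "At \<noteq> {}"
    using cardAt sing(1)[of z] card_of_empty ordLeq_ordLess_trans by metis
  then obtain a where a: "a \<in> At"
    by blast
  \<comment> \<open>The atom \<open>a\<close> has too many upper bounds for \<open>a\<close> to be
    the only one. The bound \<open>y0\<close> obtained here is strictly above an atom and will be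
    the image of the first atom.\<close>
  have "\<not> {u \<in> P. \<forall>s\<in>{a}. (s, u) \<in> le} \<subseteq> {a}"
    using ub[of "{a}"] a AtP sing card_of_mono1 ordLeq_ordLess_trans by blast
  then obtain y0 where y0: "y0 \<in> P" "(a, y0) \<in> le" "y0 \<noteq> a"
    by blast
  have y0z: "y0 \<noteq> z"
    using y0(2) a zAt AtP z(2) antisymD[OF antisym] by blast

  obtain R where R: "wf R" "R \<subseteq> P \<times> P" "total_on P R"
    "\<And>x y. \<lbrakk>(x, y) \<in> le; x \<noteq> y\<rbrakk> \<Longrightarrow> (x, y) \<in> R"
    "\<And>x. x \<in> P \<Longrightarrow> |{y. (y, x) \<in> R}| <o |P|"
    using linear_extension_small_segments[OF lam assms(6,12,13)] by blast
  have wow: "Well_order |P|"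
    by (rule card_of_Well_order)

  \<comment> \<open>Recursive construction of the map\<close>
  define used where "used = (\<lambda>f :: 'a \<Rightarrow> 'a. \<lambda>x. f ` {y. (y, x) \<in> R})"
  \<comment> \<open>\<open>Q f x v\<close> means that \<open>v\<close> is admissible at
    \<open>x\<close>, given \<open>f\<close> on the \<open>R\<close>-predecessors of
    \<open>x\<close>. It is vacuous outside \<open>P\<close>, so that the recursion can run over the
    whole type.\<close>
  define Q where "Q = (\<lambda>f x v. x \<in> P \<longrightarrow> (if x = z then v = z else
      v \<in> P - used f x \<and>
      (if x \<in> At then (if y0 \<notin> used f x then v = y0 else \<forall>v'\<in>P - used f x. (v, v') \<in> |P| )
       else \<forall>y. (y, x) \<in> le \<and> y \<noteq> x \<longrightarrow> (f y, v) \<in> le)))"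
  have "\<exists>f. \<forall>x. Q f x (f x)"
  proof (rule dependent_wf_choice[OF R(1)])
    fix f g :: "'a \<Rightarrow> 'a" and x v
    assume eq: "\<And>y. (y, x) \<in> R \<Longrightarrow> f y = g y"
    then have "used f x = used g x"
      by (force simp: used_def)
    moreover have "f y = g y" if "(y, x) \<in> le" "y \<noteq> x" for y
      using eq R(4) that by blast
    ultimately show "Q f x v = Q g x v"
      unfolding Q_def by (simp cong: conj_cong imp_cong)
  next
    fix x and f :: "'a \<Rightarrow> 'a"
    assume IH: "\<And>y. (y, x) \<in> R \<Longrightarrow> Q f y (f y)"
    show "\<exists>v. Q f x v"
    proof (cases "x \<in> P \<and> x \<noteq> z")
      case False
      then show ?thesis
        by (auto simp: Q_def)
    next
      case True
      have small: "|used f x| <o |P|"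
        using R(5) True card_of_image ordLeq_ordLess_trans unfolding used_def by blast
      show ?thesis
      proof (cases "x \<in> At")
        case True
        have "P - used f x \<noteq> {}"
          using small card_of_mono1[of P "used f x"] not_ordLess_ordLeq by blast
        then obtain v where "v \<in> P - used f x" "\<And>v'. v' \<in> P - used f x \<Longrightarrow> (v, v') \<in> |P|"
          using well_order_least[OF wow, of "P - used f x"] unfolding Field_card_of by blast
        then have "Q f x (if y0 \<notin> used f x then y0 else v)"
          using \<open>x \<in> P \<and> x \<noteq> z\<close> True y0(1) by (simp add: Q_def)
        then show ?thesis ..
      next
        case False
        let ?D = "{y. (y, x) \<in> le \<and> y \<noteq> x}"
        let ?U = "{u \<in> P. \<forall>s\<in>f ` ?D. (s, u) \<in> le}"
        have "f y \<in> P" if "(y, x) \<in> R" for y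
          using IH[OF that] that R(2) z(1) by (auto simp: Q_def split: if_splits)
        then have "f ` ?D \<subseteq> P"
          using R(4) by blast
        moreover have "|f ` ?D| <o lam"
        proof -
          have "?D \<subseteq> down_set P le x"
            using le_P by (auto simp: down_set_def)
          then have "|?D| <o lam"
            using assms(13) \<open>x \<in> P \<and> x \<noteq> z\<close> card_of_mono1 ordLeq_ordLess_trans by blast
          then show ?thesis
            using card_of_image ordLeq_ordLess_trans by blast
        qed
        \<comment> \<open>The images of the points below \<open>x\<close> have \<open>|P|\<close>
          common upper bounds, while fewer than \<open>|P|\<close> values are used, so an upper
          bound is free.\<close>
        ultimately have "\<not> |?U| <o |P|"
          by (rule ub)
        then have "\<not> ?U \<subseteq> used f x"
          using small card_of_mono1 ordLeq_ordLess_trans by blast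
        then obtain v where "v \<in> ?U" "v \<notin> used f x"
          by blast
        then have "Q f x v"
          using False \<open>x \<in> P \<and> x \<noteq> z\<close> by (auto simp: Q_def)
        then show ?thesis ..
      qed
    qed
  qed
  then obtain f where f: "\<And>x. Q f x (f x)"
    by blast

  \<comment> \<open>Monotonicity and bijectivity\<close>
  have fz: "f z = z"
    using f[of z] z(1) by (simp add: Q_def)
  have fP: "f x \<in> P" if "x \<in> P" for x
    using f[of x] that z(1) by (auto simp: Q_def split: if_splits)
  have not_used: "f x \<notin> used f x" if "x \<in> P" for x
  proof (cases "x = z")
    case True
    \<comment> \<open>\<open>Q\<close> does not ask for a fresh value at the root; there nothing is
      used yet, because \<open>R\<close> extends \<open>le\<close> and so starts with
      \<open>z\<close>.\<close>
    have "(y, z) \<notin> R" for y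
      using R(2) R(4)[of z y] z wf_not_sym[OF R(1), of y z] wf_not_refl[OF R(1), of z] by blast
    then show ?thesis
      using True by (simp add: used_def)
  next
    case False
    then show ?thesis
      using f[of x] that by (auto simp: Q_def)
  qed
  have inj: "inj_on f P"
  proof (rule inj_onI, rule ccontr)
    fix x y assume "x \<in> P" "y \<in> P" "f x = f y" "x \<noteq> y"
    moreover from this have "(x, y) \<in> R \<or> (y, x) \<in> R"
      using R(3) by (simp add: total_on_def)
    ultimately show False
      using not_used unfolding used_def by (metis imageI mem_Collect_eq)
  qed
  have mono: "(f x, f y) \<in> le" if "x \<in> P" "y \<in> P" "(x, y) \<in> le" for x y
  proof -
    consider "x = y" | "x \<noteq> y" "y \<in> At" | "x \<noteq> y" "y \<notin> At"
      by blast
    then show ?thesis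
    proof cases
      case 1
      then show ?thesis
        using refl_le fP that by blast
    next
      case 2
      \<comment> \<open>Only the root lies strictly below an atom, and it is fixed, so atoms can be
        sent anywhere.\<close>
      then show ?thesis
        using below_At that fz z(2) fP by metis
    next
      case 3
      moreover have "y \<noteq> z"
        using 3 that z(2) antisymD[OF antisym] by blast
      ultimately show ?thesis
        using f[of y] that by (simp add: Q_def)
    qed
  qed
  have "P \<subseteq> f ` P"
  proof
    fix y assume y: "y \<in> P"
    show "y \<in> f ` P"
    proof (rule ccontr)
      assume "y \<notin> f ` P"
      then have "y \<in> P - used f x" for x
        using y R(2) by (auto simp: used_def)
      then have "f x = y0 \<or> (f x, y) \<in> |P|" if "x \<in> At" for x
        using f[of x] that AtP zAt by (auto simp: Q_def split: if_splits)
      then have sub: "f ` At \<subseteq> {y0} \<union> ({y} \<union> underS (card_of P) y)"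
        by (auto simp: underS_def)
      have "|underS (card_of P) y| <o |P|"
        using card_of_underS[OF card_of_Card_order, of y P] y by (simp add: Field_card_of)
      then have "|{y0} \<union> ({y} \<union> underS (card_of P) y)| <o |P|"
        by (intro card_of_Un_ordLess_infinite[OF infP] sing)
      then have "|f ` At| <o |P|"
        using sub card_of_mono1 ordLeq_ordLess_trans by blast
      moreover have "|At| \<le>o |f ` At|"
        using inj AtP by (meson card_of_ordLeq inj_on_subset order_refl)
      ultimately show False
        using cardAt ordLeq_ordLess_trans by blast
    qed
  qed
  with inj fP have bij: "bij_betw f P P"
    by (auto simp: bij_betw_def)

  \<comment> \<open>Failure of order reflection at the first atom\<close>
  obtain a0 where a0: "a0 \<in> P - {z}" "\<And>y. (y, a0) \<in> R \<Longrightarrow> y \<notin> P - {z}"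
    using wfE_min[OF R(1), of a "P - {z}"] a AtP zAt by blast
  \<comment> \<open>\<open>a0\<close> is \<open>R\<close>-first after the root, and an element of
    \<open>P - {z}\<close> strictly below it would come earlier in \<open>R\<close>.\<close>
  have a0At: "a0 \<in> At"
    using a0 R(4) by (auto simp: At_def min_elements_def)
  have "y0 \<notin> used f a0"
    using a0(2) R(2) fz y0z by (auto simp: used_def)
  then have fa0: "f a0 = y0"
    using f[of a0] a0 a0At by (auto simp: Q_def)
  have "\<not> poset_automorphism P le f"
  proof
    assume aut: "poset_automorphism P le f"
    \<comment> \<open>If \<open>f\<close> reflected the order, \<open>a\<close> below
      \<open>y0 = f a0\<close> would force its preimage strictly below the atom \<open>a0\<close>.
      That preimage would be \<open>z\<close>, but \<open>f\<close> sends \<open>z\<close> to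
      \<open>z\<close> and not to \<open>a\<close>.\<close>
    obtain x where x: "x \<in> P" "f x = a"
      using bij a AtP by (metis bij_betw_imp_surj_on imageE subsetD)
    then have "(x, a0) \<in> le"
      using aut y0(2) fa0 a0(1) by (auto simp: poset_automorphism_def)
    moreover have "x \<noteq> a0"
      using x fa0 y0(3) by blast
    ultimately have "x = z"
      using below_At a0At by blast
    then show False
      using x fz a zAt by simp
  qed
  with bij mono show ?thesis
    unfolding reversible_def by blast
qed

end
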